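(* Let $R$ be a commutative Noetherian ring with identity and let $\mathbf{x}=x_1,\ldots,x_d$ be a regular $R$-sequence contained in the Jacobson radical of $R$. Then a monomial ideal of $R$ with respect to $\mathbf{x}$ is irreducible if and only if it is a generalized-parameter ideal.
   Context: A monomial with respect to $\mathbf{x}$ is an element $x_1^{e_1}\cdots x_d^{e_d}$ of $R$ with $e_1,\ldots,e_d$ non-negative integers. A monomial ideal with respect to $\mathbf{x}$ is an ideal generated by monomials with respect to $\mathbf{x}$; in particular, the zero ideal and $R$ itself are counted as monomial ideals. A monomial ideal $I$ with respect to $\mathbf{x}$ is reducible if there exist two monomial ideals $I_1,I_2$ of $R$ with respect to $\mathbf{x}$ such that $I=I_1\cap I_2$ and $I\neq I_1$, $I\neq I_2$; it is irreducible if it is not reducible. A generalized-parameter ideal (also called generalized-parametric ideal) is a monomial ideal generated by $x_{\tau(1)}^{e_1},\ldots,x_{\tau(s)}^{e_s}$, where $s$ is an integer with $1\le s\le d$, $\tau$ is a permutation of $\{1,\ldots,d\}$ and the $e_i$ are positive integers.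
   Formalization: The equivalence is stated for irreducible monomial ideals other than the zero ideal and R itself, since these two are irreducible under the stated definition but are never generalized-parameter ideals. *)

theory Defs
  imports "HOL-Algebra.Algebra" "HOL-Combinatorics.Permutations"
begin

definition jacobson_radical :: "('a, 'b) ring_scheme \<Rightarrow> 'a set" where
  "jacobson_radical R = {a \<in> carrier R. \<forall>M. maximalideal M R \<longrightarrow> a \<in> M}"

text \<open>
  A sequence \<open>x\<^sub>1, \<dots>, x\<^sub>d\<close> is a function on \<open>nat\<close> of which only the values at \<open>1, \<dots>, d\<close> matter.
  In the condition on \<open>x\<^sub>i\<close> the ring \<open>R Quot J\<close> is \<open>R/(x\<^sub>1, \<dots>, x\<^bsub>i-1\<^esub>)\<close>, which is \<open>R/(0)\<close> for
  \<open>i = 1\<close>.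
\<close>

definition regular_sequence ::
  "('a, 'b) ring_scheme \<Rightarrow> nat \<Rightarrow> (nat \<Rightarrow> 'a) \<Rightarrow> bool" where
  "regular_sequence R d x \<longleftrightarrow>
     x ` {1..d} \<subseteq> carrier R \<and>
     (\<forall>i\<in>{1..d}. let J = Idl\<^bsub>R\<^esub> (x ` {1..<i}) in
        \<forall>r \<in> carrier (R Quot J).
          (J +>\<^bsub>R\<^esub> x i) \<otimes>\<^bsub>R Quot J\<^esub> r = \<zero>\<^bsub>R Quot J\<^esub> \<longrightarrow> r = \<zero>\<^bsub>R Quot J\<^esub>) \<and>
     Idl\<^bsub>R\<^esub> (x ` {1..d}) \<noteq> carrier R"

definition monomials :: "('a, 'b) ring_scheme \<Rightarrow> nat \<Rightarrow> (nat \<Rightarrow> 'a) \<Rightarrow> 'a set" where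
  "monomials R d x =
     {(\<Otimes>\<^bsub>R\<^esub>i\<in>{1..d}. x i [^]\<^bsub>R\<^esub> e i) | e :: nat \<Rightarrow> nat. True}"

text \<open>The generating set may be empty, which gives the zero ideal; the ring itself is generated by
  the monomial \<open>1\<close>.\<close>

definition monomial_ideal ::
  "('a, 'b) ring_scheme \<Rightarrow> nat \<Rightarrow> (nat \<Rightarrow> 'a) \<Rightarrow> 'a set \<Rightarrow> bool" where
  "monomial_ideal R d x I \<longleftrightarrow> (\<exists>S \<subseteq> monomials R d x. I = Idl\<^bsub>R\<^esub> S)"

definition reducible_monomial_ideal ::
  "('a, 'b) ring_scheme \<Rightarrow> nat \<Rightarrow> (nat \<Rightarrow> 'a) \<Rightarrow> 'a set \<Rightarrow> bool" where
  "reducible_monomial_ideal R d x I \<longleftrightarrow>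
     monomial_ideal R d x I \<and>
     (\<exists>I\<^sub>1 I\<^sub>2. monomial_ideal R d x I\<^sub>1 \<and> monomial_ideal R d x I\<^sub>2 \<and>
        I = I\<^sub>1 \<inter> I\<^sub>2 \<and> I \<noteq> I\<^sub>1 \<and> I \<noteq> I\<^sub>2)"

definition irreducible_monomial_ideal ::
  "('a, 'b) ring_scheme \<Rightarrow> nat \<Rightarrow> (nat \<Rightarrow> 'a) \<Rightarrow> 'a set \<Rightarrow> bool" where
  "irreducible_monomial_ideal R d x I \<longleftrightarrow>
     monomial_ideal R d x I \<and> \<not> reducible_monomial_ideal R d x I"

definition generalized_parameter_ideal ::
  "('a, 'b) ring_scheme \<Rightarrow> nat \<Rightarrow> (nat \<Rightarrow> 'a) \<Rightarrow> 'a set \<Rightarrow> bool" where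
  "generalized_parameter_ideal R d x I \<longleftrightarrow>
     monomial_ideal R d x I \<and>
     (\<exists>s \<tau>. \<exists>e :: nat \<Rightarrow> nat. 1 \<le> s \<and> s \<le> d \<and> \<tau> permutes {1..d} \<and> (\<forall>i\<in>{1..s}. 0 < e i) \<and>
        I = Idl\<^bsub>R\<^esub> ((\<lambda>i. x (\<tau> i) [^]\<^bsub>R\<^esub> e i) ` {1..s}))"

end

theory Submission
  imports Defs
begin

text \<open>
  By Nakayama's lemma each \<open>x i\<close> is regular modulo the ideal generated by any set of the other \<open>x j\<close>.
  This makes monomial ideals behave as in a polynomial ring: the colon ideal \<open>I : x\<^sup>a\<close> of a monomial
  ideal is generated by the monomials \<open>x\<^sup>t\<close> divided by their common part with \<open>x\<^sup>a\<close>. Hence membership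
  of a monomial is decided by divisibility of exponents, and \<open>(I + (x\<^sup>a)) \<inter> (I + (x\<^sup>b)) = I\<close> as soon as
  the least common multiple of \<open>x\<^sup>a\<close> and \<open>x\<^sup>b\<close> lies in \<open>I\<close>. So \<open>I\<close> is irreducible iff the exponents of
  the monomials outside \<open>I\<close> are closed under componentwise maxima, which means that they form a box
  \<open>{a. \<forall>i\<in>A. a i < e i}\<close>, and the complement of a box is generated by the powers
  \<open>x i ^ e i\<close> with \<open>i \<in> A\<close>.
\<close>

section \<open>Ideals and the Jacobson radical\<close>

lemma (in cring) ideal_of_closed:
  assumes "I \<subseteq> carrier R" and "\<zero> \<in> I"
    and "\<And>a b. a \<in> I \<Longrightarrow> b \<in> I \<Longrightarrow> a \<oplus> b \<in> I"
    and "\<And>a r. a \<in> I \<Longrightarrow> r \<in> carrier R \<Longrightarrow> r \<otimes> a \<in> I"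
  shows "ideal I R"
proof (rule idealI)
  show "ring R" by (rule ring_axioms)
  show "subgroup I (add_monoid R)"
  proof (rule add.subgroupI)
    show "\<ominus> a \<in> I" if "a \<in> I" for a
      using assms(4)[OF that, of "\<ominus> \<one>"] assms(1) that l_minus[of \<one> a] by (simp add: subset_iff)
  qed (use assms in auto)
  show "r \<otimes> a \<in> I" if "a \<in> I" "r \<in> carrier R" for a r
    using assms(4) that by blast
  show "a \<otimes> r \<in> I" if "a \<in> I" "r \<in> carrier R" for a r
    using assms(1,4) that m_comm by (metis subsetD)
qed

context ideal
begin

lemma I_add_closed: "a \<in> I \<Longrightarrow> b \<in> I \<Longrightarrow> a \<oplus> b \<in> I"
  by (rule additive_subgroup.a_closed[OF is_additive_subgroup])

lemma I_uminus_closed: "a \<in> I \<Longrightarrow> \<ominus> a \<in> I"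
  by (rule additive_subgroup.a_inv_closed[OF is_additive_subgroup])

lemma I_add_cancel_left:
  assumes "a \<in> I" "b \<in> carrier R" "a \<oplus> b \<in> I" shows "b \<in> I"
proof -
  have "\<ominus> a \<oplus> (a \<oplus> b) = b"
    using assms(2) Icarr[OF assms(1)] by (simp add: r_neg1)
  then show ?thesis
    using I_add_closed[OF I_uminus_closed[OF assms(1)] assms(3)] by simp
qed

end

lemma (in cring) colon_ideal:
  assumes "ideal I R" "b \<in> carrier R"
  shows "ideal {k \<in> carrier R. b \<otimes> k \<in> I} R" (is "ideal ?K R")
proof (rule ideal_of_closed)
  interpret I: ideal I R by fact
  show "p \<oplus> q \<in> ?K" if "p \<in> ?K" "q \<in> ?K" for p q
    using that assms(2) I.I_add_closed by (auto simp: r_distr)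
  show "r \<otimes> p \<in> ?K" if "p \<in> ?K" "r \<in> carrier R" for p r
    using that assms(2) I.I_l_closed by (auto simp: m_lcomm[of b])
qed (use assms additive_subgroup.zero_closed[OF ideal.axioms(1)] in auto)

text \<open>The elements of the form \<open>u \<oplus> a \<otimes> r\<close> already form an ideal
  containing \<open>insert a G\<close>, so minimality of the generated ideal applies.\<close>

lemma (in cring) Idl_insertE:
  assumes "G \<subseteq> carrier R" "a \<in> carrier R" "z \<in> Idl (insert a G)"
  obtains u r where "u \<in> Idl G" "r \<in> carrier R" "z = u \<oplus> a \<otimes> r"
proof -
  interpret G: ideal "Idl G" R using assms(1) by (rule genideal_ideal)
  define K where "K = {u \<oplus> a \<otimes> r | u r. u \<in> Idl G \<and> r \<in> carrier R}"
  have K: "z \<in> K" if "z = u \<oplus> a \<otimes> r" "u \<in> Idl G" "r \<in> carrier R" for z u r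
    using that unfolding K_def by blast
  have "ideal K R"
  proof (rule ideal_of_closed)
    show "K \<subseteq> carrier R" using assms(2) G.Icarr by (auto simp: K_def)
    show "\<zero> \<in> K" using assms(2) by (intro K[of _ \<zero> \<zero>]) auto
    fix p assume "p \<in> K"
    then obtain u r where ur: "u \<in> Idl G" "r \<in> carrier R" "p = u \<oplus> a \<otimes> r"
      unfolding K_def by blast
    have u: "u \<in> carrier R" by (rule G.Icarr[OF ur(1)])
    show "p \<oplus> q \<in> K" if q: "q \<in> K" for q
    proof -
      obtain v s where vs: "v \<in> Idl G" "s \<in> carrier R" "q = v \<oplus> a \<otimes> s"
        using q unfolding K_def by blast
      have v: "v \<in> carrier R" by (rule G.Icarr[OF vs(1)])
      have "p \<oplus> q = (u \<oplus> v) \<oplus> a \<otimes> (r \<oplus> s)"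
        unfolding ur(3) vs(3) using ur(2) vs(2) assms(2) u v by algebra
      then show ?thesis by (rule K) (use ur vs G.I_add_closed in auto)
    qed
    show "s \<otimes> p \<in> K" if "s \<in> carrier R" for s
    proof -
      have "s \<otimes> p = s \<otimes> u \<oplus> a \<otimes> (s \<otimes> r)"
        unfolding ur(3) using ur(2) that assms(2) u by algebra
      then show ?thesis by (rule K) (use ur that G.I_l_closed in auto)
    qed
  qed
  moreover have "insert a G \<subseteq> K"
  proof -
    have "a \<in> K" using assms(2) by (intro K[of _ \<zero> \<one>]) auto
    moreover have "g \<in> K" if "g \<in> G" for g
    proof (rule K[of _ g \<zero>])
      show "g \<in> Idl G" using genideal_self[OF assms(1)] that by blast
    qed (use that assms in auto)
    ultimately show ?thesis by blast
  qed
  ultimately have "Idl (insert a G) \<subseteq> K" by (rule genideal_minimal)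
  with assms(3) that show thesis unfolding K_def by blast
qed

lemma (in cring) Idl_insertI:
  assumes "G \<subseteq> carrier R" "a \<in> carrier R" "u \<in> Idl G" "r \<in> carrier R"
  shows "u \<oplus> a \<otimes> r \<in> Idl (insert a G)"
proof -
  interpret ideal "Idl (insert a G)" R using assms by (intro genideal_ideal) auto
  have "u \<in> Idl (insert a G)"
    using subset_Idl_subset[of "insert a G" G] assms by auto
  moreover have "a \<in> Idl (insert a G)"
    using genideal_self[of "insert a G"] assms by auto
  ultimately show ?thesis using I_r_closed assms(4) I_add_closed by simp
qed

text \<open>The elements that need only finitely many generators form an ideal containing
  \<open>S\<close>. This later reduces regularity modulo a monomial ideal to finite generating sets,
  where the total degree is available for induction.\<close>

lemma (in cring) Idl_finite_support:
  assumes "S \<subseteq> carrier R" "a \<in> Idl S"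
  obtains F where "finite F" "F \<subseteq> S" "a \<in> Idl F"
proof -
  define K where "K = {a. \<exists>F. finite F \<and> F \<subseteq> S \<and> a \<in> Idl F}"
  have idl: "ideal (Idl F) R" if "F \<subseteq> S" for F
    using that assms(1) by (intro genideal_ideal) auto
  have "ideal K R"
  proof (rule ideal_of_closed)
    show "K \<subseteq> carrier R"
      using ideal.Icarr[OF idl] by (auto simp: K_def)
    have "\<zero> \<in> Idl {}"
      using idl[of "{}"] additive_subgroup.zero_closed[OF ideal.axioms(1)] by simp
    then show "\<zero> \<in> K"
      unfolding K_def by blast
    fix p assume "p \<in> K"
    then obtain F where F: "finite F" "F \<subseteq> S" "p \<in> Idl F" unfolding K_def by blast
    show "p \<oplus> q \<in> K" if q: "q \<in> K" for q
    proof -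
      obtain G where G: "finite G" "G \<subseteq> S" "q \<in> Idl G" using q unfolding K_def by blast
      have FG: "F \<union> G \<subseteq> S" using F G by blast
      have "p \<in> Idl (F \<union> G)" "q \<in> Idl (F \<union> G)"
        using F G FG subset_Idl_subset[of "F \<union> G"] assms(1) by blast+
      then have "p \<oplus> q \<in> Idl (F \<union> G)"
        by (rule ideal.I_add_closed[OF idl[OF FG]])
      then show ?thesis unfolding K_def using F(1) G(1) FG by blast
    qed
    show "r \<otimes> p \<in> K" if "r \<in> carrier R" for r
      unfolding K_def using F(1,2) ideal.I_l_closed[OF idl[OF F(2)] F(3) that] by blast
  qed
  moreover have "S \<subseteq> K"
  proof
    fix s assume "s \<in> S"
    then have "s \<in> Idl {s}" using assms(1) by (auto intro: genideal_self')
    then show "s \<in> K" unfolding K_def using \<open>s \<in> S\<close> by blast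
  qed
  ultimately have "Idl S \<subseteq> K" by (rule genideal_minimal)
  with assms(2) show thesis using that unfolding K_def by blast
qed

section \<open>Maximal elements, units and Nakayama's lemma\<close>

lemma (in noetherian_ring) ex_maximal_ideal_of_family:
  assumes "J \<in> S" and "\<And>I. I \<in> S \<Longrightarrow> ideal I R"
  shows "\<exists>M\<in>S. \<forall>I\<in>S. M \<subseteq> I \<longrightarrow> I = M"
proof (rule subset_Zorn_nonempty)
  show "S \<noteq> {}" using assms(1) by blast
  fix C assume C: "C \<noteq> {}" "subset.chain S C"
  then have "subset.chain {I. ideal I R} C"
    using assms(2) by (simp add: subset_chain_def subset_iff)
  \<comment> \<open>By the ascending chain condition a nonempty chain of ideals contains its own
    union, which serves as the upper bound for Zorn's lemma.\<close>
  then have "\<Union>C \<in> C" by (rule ideal_chain_is_trivial[OF C(1)])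
  then show "\<Union>C \<in> S" using C(2) by (auto simp: subset_chain_def)
qed

locale noetherian_cring = cring + noetherian_ring
begin

text \<open>A non-unit \<open>b\<close> lies in an ideal that is maximal among the proper ideals
  containing it. With \<open>b = \<one> \<ominus> a \<otimes> r\<close> this ideal also contains
  \<open>a\<close>, hence \<open>\<one>\<close>.\<close>

lemma one_minus_jacobson_Units:
  assumes "a \<in> jacobson_radical R" "r \<in> carrier R"
  shows "\<one> \<ominus> a \<otimes> r \<in> Units R"
proof (rule ccontr)
  have a: "a \<in> carrier R" using assms unfolding jacobson_radical_def by blast
  define b where "b = \<one> \<ominus> a \<otimes> r"
  have b: "b \<in> carrier R" using a assms by (simp add: b_def)
  assume "\<one> \<ominus> a \<otimes> r \<notin> Units R"
  then have nu: "b \<notin> Units R" by (simp add: b_def)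
  define S where "S = {I. ideal I R \<and> b \<in> I \<and> I \<noteq> carrier R}"
  have "PIdl b \<in> S"
  proof -
    have "\<one> \<notin> PIdl b"
    proof
      assume "\<one> \<in> PIdl b"
      then obtain s where "s \<in> carrier R" "\<one> = s \<otimes> b" unfolding cgenideal_def by blast
      then show False using nu b m_comm unfolding Units_def by force
    qed
    then show ?thesis
      unfolding S_def using cgenideal_ideal[OF b] cgenideal_self[OF b] by auto
  qed
  then have "\<exists>M\<in>S. \<forall>I\<in>S. M \<subseteq> I \<longrightarrow> I = M"
    by (rule ex_maximal_ideal_of_family) (simp add: S_def)
  then obtain M where M: "M \<in> S" "\<And>I. I \<in> S \<Longrightarrow> M \<subseteq> I \<Longrightarrow> I = M"
    by auto
  interpret M: ideal M R using M(1) unfolding S_def by blast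
  have "maximalideal M R"
  proof (rule maximalidealI)
    show "ideal M R" by (rule M.is_ideal)
    show "carrier R \<noteq> M" using M(1) unfolding S_def by blast
    show "J = M \<or> J = carrier R" if "ideal J R" "M \<subseteq> J" "J \<subseteq> carrier R" for J
      using M that unfolding S_def by blast
  qed
  then have "a \<in> M" using assms unfolding jacobson_radical_def by blast
  then have "a \<otimes> r \<oplus> b \<in> M"
    using M(1) assms(2) M.I_r_closed M.I_add_closed unfolding S_def by simp
  moreover have "a \<otimes> r \<oplus> b = \<one>" unfolding b_def using a assms(2) by algebra
  ultimately show False using M(1) M.one_imp_carrier unfolding S_def by auto
qed

text \<open>The last hypothesis says \<open>K = J + aK\<close>. If \<open>K\<close> were larger than
  \<open>J\<close>, take \<open>L\<close> maximal among the ideals between \<open>J\<close> and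
  \<open>K\<close> that differ from \<open>K\<close>. Adjoining any \<open>k\<close> outside
  \<open>L\<close> gives all of \<open>K\<close>, so
  \<open>k = j \<oplus> a \<otimes> (u \<oplus> k \<otimes> r)\<close> with \<open>j\<close> and
  \<open>u\<close> in \<open>L\<close>. Then
  \<open>(\<one> \<ominus> a \<otimes> r) \<otimes> k\<close> lies in \<open>L\<close>, and its
  first factor is a unit.\<close>

lemma nakayama:
  assumes "ideal J R" "ideal K R" "a \<in> jacobson_radical R" "J \<subseteq> K"
    and "\<And>k. k \<in> K \<Longrightarrow> \<exists>j\<in>J. \<exists>k'\<in>K. k = j \<oplus> a \<otimes> k'"
  shows "K = J"
proof (rule ccontr)
  interpret K: ideal K R by fact
  have a: "a \<in> carrier R" using assms unfolding jacobson_radical_def by blast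
  assume "K \<noteq> J"
  define S where "S = {L. ideal L R \<and> J \<subseteq> L \<and> L \<subset> K}"
  have "J \<in> S" using assms \<open>K \<noteq> J\<close> unfolding S_def by blast
  then have "\<exists>L\<in>S. \<forall>I\<in>S. L \<subseteq> I \<longrightarrow> I = L"
    by (rule ex_maximal_ideal_of_family) (simp add: S_def)
  then obtain L where L: "L \<in> S" "\<And>I. I \<in> S \<Longrightarrow> L \<subseteq> I \<Longrightarrow> I = L"
    by auto
  interpret L: ideal L R using L(1) unfolding S_def by blast
  obtain k where k: "k \<in> K" "k \<notin> L" using L(1) unfolding S_def by blast
  have kc: "k \<in> carrier R" using k K.Icarr by blast
  have IdlL: "Idl L = L"
    using genideal_minimal[OF L.is_ideal] genideal_self[OF L.a_subset] by blast
  have insL: "insert k L \<subseteq> carrier R" using kc L.a_subset by blast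
  define L' where "L' = Idl (insert k L)"
  have L': "ideal L' R" "insert k L \<subseteq> L'" "L' \<subseteq> K"
    unfolding L'_def using genideal_ideal[OF insL] genideal_self[OF insL] genideal_minimal[OF K.is_ideal, of "insert k L"] k L(1)
    unfolding S_def by auto
  have "L' = K"
  proof (rule ccontr)
    assume "L' \<noteq> K"
    then have "L' \<in> S" using L' L(1) unfolding S_def by blast
    then show False using L(2) L' k by blast
  qed
  obtain j k' where jk: "j \<in> J" "k' \<in> K" "k = j \<oplus> a \<otimes> k'" using assms(5) k by blast
  then have "k' \<in> Idl (insert k L)" using \<open>L' = K\<close> L'_def by blast
  then obtain u r where ur: "u \<in> L" "r \<in> carrier R" "k' = u \<oplus> k \<otimes> r"
    using Idl_insertE[OF L.a_subset kc] IdlL by metis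
  have jL: "j \<in> L" using jk(1) L(1) unfolding S_def by blast
  have carr: "j \<in> carrier R" "u \<in> carrier R" using jL ur(1) L.Icarr by blast+
  define w where "w = \<one> \<ominus> a \<otimes> r"
  have w: "w \<in> Units R" unfolding w_def by (rule one_minus_jacobson_Units[OF assms(3) ur(2)])
  have eq: "k = j \<oplus> a \<otimes> (u \<oplus> k \<otimes> r)" using jk(3) ur(3) by simp
  have "w \<otimes> k = k \<ominus> a \<otimes> (k \<otimes> r)"
    unfolding w_def using kc a ur(2) by algebra
  also have "\<dots> = (j \<oplus> a \<otimes> (u \<oplus> k \<otimes> r)) \<ominus> a \<otimes> (k \<otimes> r)"
    by (rule arg_cong[OF eq])
  also have "\<dots> = j \<oplus> a \<otimes> u"
    using carr kc a ur(2) by algebra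
  finally have "w \<otimes> k = j \<oplus> a \<otimes> u" .
  moreover have "j \<oplus> a \<otimes> u \<in> L" using jL ur(1) a L.I_l_closed L.I_add_closed by simp
  ultimately have "inv w \<otimes> (w \<otimes> k) \<in> L" using w L.I_l_closed by auto
  then have "k \<in> L" using w kc by (simp add: m_assoc[symmetric] Units_closed)
  with k show False by blast
qed

end

section \<open>Regular elements modulo an ideal\<close>

text \<open>Regularity of the class of \<open>a\<close> in the quotient by \<open>J\<close>, phrased
  with representatives to avoid cosets. It holds vacuously when \<open>J\<close> is the whole
  ring.\<close>

definition regular_modulo :: "('a, 'b) ring_scheme \<Rightarrow> 'a set \<Rightarrow> 'a \<Rightarrow> bool" where
  "regular_modulo R J a \<longleftrightarrow> (\<forall>r\<in>carrier R. a \<otimes>\<^bsub>R\<^esub> r \<in> J \<longrightarrow> r \<in> J)"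

lemma regular_moduloD:
  "regular_modulo R J a \<Longrightarrow> r \<in> carrier R \<Longrightarrow> a \<otimes>\<^bsub>R\<^esub> r \<in> J \<Longrightarrow> r \<in> J"
  unfolding regular_modulo_def by blast

lemma (in ideal) regular_modulo_quotient:
  assumes "a \<in> carrier R"
    and "\<forall>r\<in>carrier (R Quot I). (I +> a) \<otimes>\<^bsub>R Quot I\<^esub> r = \<zero>\<^bsub>R Quot I\<^esub> \<longrightarrow> r = \<zero>\<^bsub>R Quot I\<^esub>"
  shows "regular_modulo R I a"
  unfolding regular_modulo_def
proof (intro ballI impI)
  fix r assume r: "r \<in> carrier R" "a \<otimes> r \<in> I"
  have "I +> r \<in> carrier (R Quot I)"
    using r by (auto simp: FactRing_def A_RCOSETS_def')
  moreover have "(I +> a) \<otimes>\<^bsub>R Quot I\<^esub> (I +> r) = \<zero>\<^bsub>R Quot I\<^esub>"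
    using assms r rcoset_mult_add[OF assms(1) r(1)] a_rcos_zero[OF is_ideal r(2)]
    by (simp add: FactRing_def)
  ultimately have "I +> r = I" using assms(2) by (auto simp: FactRing_def)
  then show "r \<in> I" using rcos_const_imp_mem r(1) by blast
qed

text \<open>If \<open>a \<otimes> r = u \<oplus> b \<otimes> s\<close>, then regularity of
  \<open>b\<close> modulo \<open>insert a G\<close> gives
  \<open>s = v \<oplus> a \<otimes> t\<close>. Hence
  \<open>a \<otimes> (r \<ominus> b \<otimes> t)\<close> lies in \<open>Idl G\<close>, and
  cancelling \<open>a\<close> puts \<open>r\<close> in the ideal generated by
  \<open>insert b G\<close>.\<close>

lemma (in cring) regular_modulo_swap:
  assumes "G \<subseteq> carrier R" "a \<in> carrier R" "b \<in> carrier R"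
    and "regular_modulo R (Idl G) a" "regular_modulo R (Idl (insert a G)) b"
  shows "regular_modulo R (Idl (insert b G)) a"
  unfolding regular_modulo_def
proof (intro ballI impI)
  interpret G: ideal "Idl G" R using assms(1) by (rule genideal_ideal)
  fix r assume r: "r \<in> carrier R" "a \<otimes> r \<in> Idl (insert b G)"
  obtain u s where us: "u \<in> Idl G" "s \<in> carrier R" "a \<otimes> r = u \<oplus> b \<otimes> s"
    using Idl_insertE[OF assms(1,3) r(2)] .
  have u: "u \<in> carrier R" by (rule G.Icarr[OF us(1)])
  have "b \<otimes> s = \<ominus> u \<oplus> a \<otimes> r" using us u assms r by algebra
  then have "b \<otimes> s \<in> Idl (insert a G)"
    using Idl_insertI[OF assms(1,2)] G.I_uminus_closed us(1) r(1) by simp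
  then have "s \<in> Idl (insert a G)" using regular_moduloD[OF assms(5)] us by blast
  then obtain v t where vt: "v \<in> Idl G" "t \<in> carrier R" "s = v \<oplus> a \<otimes> t"
    using Idl_insertE[OF assms(1,2)] by blast
  have v: "v \<in> carrier R" by (rule G.Icarr[OF vt(1)])
  have "a \<otimes> (r \<ominus> b \<otimes> t) = u \<oplus> b \<otimes> v"
  proof -
    have "a \<otimes> (r \<ominus> b \<otimes> t) = a \<otimes> r \<ominus> b \<otimes> (a \<otimes> t)" using assms r vt by algebra
    also have "\<dots> = u \<oplus> b \<otimes> v" unfolding us(3) vt(3) using u v assms r vt by algebra
    finally show ?thesis .
  qed
  moreover have "u \<oplus> b \<otimes> v \<in> Idl G" using us vt assms G.I_l_closed G.I_add_closed by simp
  ultimately have "r \<ominus> b \<otimes> t \<in> Idl G"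
    using regular_moduloD[OF assms(4), of "r \<ominus> b \<otimes> t"] r vt assms by simp
  then have "(r \<ominus> b \<otimes> t) \<oplus> b \<otimes> t \<in> Idl (insert b G)"
    using Idl_insertI assms vt by blast
  moreover have "(r \<ominus> b \<otimes> t) \<oplus> b \<otimes> t = r" using r assms vt by algebra
  ultimately show "r \<in> Idl (insert b G)" by simp
qed

text \<open>The half of exchanging \<open>a\<close> and \<open>b\<close> that rests on the Jacobson
  radical. If \<open>b \<otimes> k\<close> lies in \<open>Idl G\<close>, then
  \<open>k = u \<oplus> a \<otimes> r\<close> by regularity of \<open>b\<close>, and cancelling
  \<open>a\<close> shows that \<open>b \<otimes> r\<close> lies in \<open>Idl G\<close> as well, so
  the argument reproduces itself with \<open>r\<close> in place of \<open>k\<close>.\<close>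

lemma (in noetherian_cring) regular_modulo_drop:
  assumes "G \<subseteq> carrier R" "a \<in> jacobson_radical R" "b \<in> carrier R"
    and "regular_modulo R (Idl G) a" "regular_modulo R (Idl (insert a G)) b"
  shows "regular_modulo R (Idl G) b"
proof -
  interpret G: ideal "Idl G" R using assms(1) by (rule genideal_ideal)
  have a: "a \<in> carrier R" using assms unfolding jacobson_radical_def by blast
  define K where "K = {k \<in> carrier R. b \<otimes> k \<in> Idl G}"
  have "ideal K R" unfolding K_def by (rule colon_ideal[OF G.is_ideal assms(3)])
  \<comment> \<open>\<open>K = aK + Idl G\<close>, so Nakayama gives \<open>K = Idl G\<close>.\<close>
  have "K = Idl G"
  proof (rule nakayama[OF G.is_ideal \<open>ideal K R\<close> assms(2)])
    show "Idl G \<subseteq> K" using G.Icarr G.I_l_closed assms(3) by (auto simp: K_def)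
    fix k assume k: "k \<in> K"
    then have "b \<otimes> k \<in> Idl (insert a G)"
      unfolding K_def using subset_Idl_subset[of "insert a G" G] assms(1) a by blast
    then have "k \<in> Idl (insert a G)" using regular_moduloD[OF assms(5)] k unfolding K_def by blast
    then obtain u r where ur: "u \<in> Idl G" "r \<in> carrier R" "k = u \<oplus> a \<otimes> r"
      using Idl_insertE[OF assms(1) a] by blast
    have u: "u \<in> carrier R" by (rule G.Icarr[OF ur(1)])
    have "b \<otimes> u \<oplus> a \<otimes> (b \<otimes> r) = b \<otimes> k" unfolding ur(3) using u ur a assms(3) by algebra
    then have "b \<otimes> u \<oplus> a \<otimes> (b \<otimes> r) \<in> Idl G" using k unfolding K_def by simp
    moreover have "b \<otimes> u \<in> Idl G" using ur assms(3) G.I_l_closed by blast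
    ultimately have "a \<otimes> (b \<otimes> r) \<in> Idl G"
      using a assms(3) ur(2) G.I_add_cancel_left[of "b \<otimes> u" "a \<otimes> (b \<otimes> r)"] by blast
    then have "b \<otimes> r \<in> Idl G" using regular_moduloD[OF assms(4)] assms(3) ur(2) by simp
    then have "r \<in> K" using ur(2) by (simp add: K_def)
    then show "\<exists>j\<in>Idl G. \<exists>k'\<in>K. k = j \<oplus> a \<otimes> k'" using ur(1,3) by blast
  qed
  then show ?thesis by (auto simp: regular_modulo_def K_def)
qed

section \<open>Independence of the order of the sequence\<close>

lemma regular_sequence_closed: "regular_sequence R d x \<Longrightarrow> x ` {1..d} \<subseteq> carrier R"
  unfolding regular_sequence_def by (rule conjunct1)

lemma regular_sequence_proper: "regular_sequence R d x \<Longrightarrow> Idl\<^bsub>R\<^esub> (x ` {1..d}) \<noteq> carrier R"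
  unfolding regular_sequence_def by (elim conjE)

lemma regular_sequence_regular:
  assumes "regular_sequence R d x" "i \<in> {1..d}"
  defines "J \<equiv> Idl\<^bsub>R\<^esub> (x ` {1..<i})"
  shows "\<forall>r\<in>carrier (R Quot J). (J +>\<^bsub>R\<^esub> x i) \<otimes>\<^bsub>R Quot J\<^esub> r = \<zero>\<^bsub>R Quot J\<^esub> \<longrightarrow> r = \<zero>\<^bsub>R Quot J\<^esub>"
  using assms(1,2) unfolding regular_sequence_def Let_def J_def by (elim conjE) (erule (1) bspec)

text \<open>Induction on the length \<open>n\<close> of the initial segment. The new element
  \<open>x (Suc n)\<close> is regular modulo all earlier ones by definition, and earlier ones can be
  discarded with \<open>regular_modulo_drop\<close>. An earlier \<open>x i\<close> stays regular
  after \<open>x (Suc n)\<close> is adjoined, by \<open>regular_modulo_swap\<close>.\<close>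

lemma (in noetherian_cring) regular_modulo_subset_of_regular_sequence:
  assumes "regular_sequence R d x" "x ` {1..d} \<subseteq> jacobson_radical R"
  shows "n \<le> d \<Longrightarrow> A \<subseteq> {1..n} \<Longrightarrow> i \<in> {1..n} - A \<Longrightarrow> regular_modulo R (Idl (x ` A)) (x i)"
proof (induction n arbitrary: A i)
  case 0
  then show ?case by simp
next
  case (Suc n)
  have xc: "x j \<in> carrier R" if "j \<in> {1..d}" for j
    using regular_sequence_closed[OF assms(1)] that by blast
  have xj: "x j \<in> jacobson_radical R" if "j \<in> {1..d}" for j
    using assms(2) that by blast
  have sub: "x ` B \<subseteq> carrier R" if "B \<subseteq> {1..n}" for B
    using that Suc.prems(1) by (intro image_subsetI xc) auto
  have top: "regular_modulo R (Idl (x ` {1..n})) (x (Suc n))"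
  proof -
    interpret ideal "Idl (x ` {1..n})" R using sub by (intro genideal_ideal) auto
    have "Suc n \<in> {1..d}" "{1..<Suc n} = {1..n}" using Suc.prems(1) by auto
    then show ?thesis
      using regular_modulo_quotient[OF xc] regular_sequence_regular[OF assms(1), of "Suc n"] by simp
  qed
  \<comment> \<open>Stated through the complement \<open>C\<close> because each step removes one
    generator: the induction starts from the full segment and enlarges \<open>C\<close>.\<close>
  have last: "regular_modulo R (Idl (x ` ({1..n} - C))) (x (Suc n))" if "C \<subseteq> {1..n}" for C
    using finite_subset[OF that finite_atLeastAtMost] that
  proof (induction C rule: finite_induct)
    case empty
    show ?case using top by simp
  next
    case (insert c C)
    let ?B = "{1..n} - insert c C"
    have B: "insert (x c) (x ` ?B) = x ` ({1..n} - C)" using insert by blast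
    have c: "c \<in> {1..d}" and n: "Suc n \<in> {1..d}" using insert.prems Suc.prems(1) by auto
    have "regular_modulo R (Idl (x ` ?B)) (x c)"
      using insert.prems Suc.prems(1) by (intro Suc.IH) auto
    moreover have "regular_modulo R (Idl (insert (x c) (x ` ?B))) (x (Suc n))"
      unfolding B using insert by blast
    ultimately show ?case
      using regular_modulo_drop[OF sub xj[OF c] xc[OF n], of ?B] by blast
  qed
  have last: "regular_modulo R (Idl (x ` B)) (x (Suc n))" if "B \<subseteq> {1..n}" for B
    using last[of "{1..n} - B"] that by (simp add: double_diff)
  have split: "{1..Suc n} = insert (Suc n) {1..n}" by auto
  consider "i = Suc n" "A \<subseteq> {1..n}" | "i \<in> {1..n}" "Suc n \<notin> A" | "i \<in> {1..n}" "Suc n \<in> A"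
    using Suc.prems unfolding split by blast
  then show ?case
  proof cases
    case 1
    then show ?thesis using last by simp
  next
    case 2
    then have "A \<subseteq> {1..n}" using Suc.prems unfolding split by blast
    then show ?thesis using 2 Suc.IH[of A i] Suc.prems by simp
  next
    case 3
    define B where "B = A - {Suc n}"
    have B: "B \<subseteq> {1..n}" and A: "A = insert (Suc n) B" and i: "i \<in> {1..n} - B"
      using 3 Suc.prems unfolding split B_def by blast+
    have iB: "insert (x i) (x ` B) = x ` insert i B" by simp
    have "regular_modulo R (Idl (x ` B)) (x i)"
      using Suc.IH[OF _ B i] Suc.prems by simp
    moreover have "regular_modulo R (Idl (insert (x i) (x ` B))) (x (Suc n))"
      unfolding iB using B i by (intro last) auto
    moreover have "i \<in> {1..d}" "Suc n \<in> {1..d}" using i Suc.prems(1) by auto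
    ultimately have "regular_modulo R (Idl (insert (x (Suc n)) (x ` B))) (x i)"
      using regular_modulo_swap[OF sub[OF B] xc xc] by blast
    then show ?thesis by (simp add: A)
  qed
qed

section \<open>Monomial ideals in a permutable regular sequence\<close>

text \<open>From here on the order of the sequence is forgotten: regularity of each variable modulo
  any set of other variables replaces the Noetherian and Jacobson conditions.\<close>

locale permutable_regular_sequence = cring R for R (structure) +
  fixes V :: "'i set" and x :: "'i \<Rightarrow> 'a"
  assumes finite_V: "finite V"
    and x_closed: "x ` V \<subseteq> carrier R"
    and x_regular: "A \<subseteq> V \<Longrightarrow> i \<in> V - A \<Longrightarrow> regular_modulo R (Idl (x ` A)) (x i)"
    and x_proper: "Idl (x ` V) \<noteq> carrier R"
begin

text \<open>Exponents are total functions, of which only the values on \<open>V\<close> matter.\<close>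

definition mon :: "('i \<Rightarrow> nat) \<Rightarrow> 'a" where
  "mon e = (\<Otimes>i\<in>V. x i [^] e i)"

definition mspan :: "('i \<Rightarrow> nat) set \<Rightarrow> 'a set" where
  "mspan T = Idl (mon ` T)"

abbreviation single :: "'i \<Rightarrow> nat \<Rightarrow> 'i \<Rightarrow> nat" where
  "single i n \<equiv> (\<lambda>_. 0)(i := n)"

section \<open>Monomials and the ideals they generate\<close>

lemma x_closed' [simp]: "i \<in> V \<Longrightarrow> x i \<in> carrier R"
  using x_closed by blast

lemma mon_closed [simp]: "mon e \<in> carrier R"
  unfolding mon_def by (rule finprod_closed) simp

lemma mon_cong: "(\<And>i. i \<in> V \<Longrightarrow> e i = f i) \<Longrightarrow> mon e = mon f"
  unfolding mon_def by (rule finprod_cong') auto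

lemma mon_add: "mon (\<lambda>i. e i + f i) = mon e \<otimes> mon f"
proof -
  have "mon (\<lambda>i. e i + f i) = (\<Otimes>i\<in>V. x i [^] e i \<otimes> x i [^] f i)"
    unfolding mon_def by (rule finprod_cong') (auto simp: nat_pow_mult)
  also have "\<dots> = mon e \<otimes> mon f"
    unfolding mon_def by (rule finprod_multf) auto
  finally show ?thesis .
qed

lemma mon_eq_one: "(\<And>i. i \<in> V \<Longrightarrow> e i = 0) \<Longrightarrow> mon e = \<one>"
  unfolding mon_def by (rule finprod_one_eqI) simp

lemma mon_single:
  assumes "i \<in> V"
  shows "mon (single i n) = x i [^] n"
proof -
  have "mon (single i n) = (\<Otimes>j\<in>V. if i = j then x j [^] n else \<one>)"
    unfolding mon_def using assms by (intro finprod_cong') auto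
  also have "\<dots> = x i [^] n"
    using assms finite_V by (intro finprod_singleton) auto
  finally show ?thesis .
qed

lemma mon_le:
  assumes "\<And>i. i \<in> V \<Longrightarrow> t i \<le> a i"
  shows "mon a = mon t \<otimes> mon (\<lambda>i. a i - t i)"
  using assms by (subst mon_add[symmetric]) (auto intro!: mon_cong)

lemma ideal_mspan: "ideal (mspan T) R"
  unfolding mspan_def by (rule genideal_ideal) auto

lemma mon_in_mspan:
  assumes "t \<in> T" "\<And>i. i \<in> V \<Longrightarrow> t i \<le> a i"
  shows "mon a \<in> mspan T"
proof -
  have "mon t \<in> mspan T"
    unfolding mspan_def using genideal_self[of "mon ` T"] assms(1) mon_closed by blast
  then have "mon t \<otimes> mon (\<lambda>i. a i - t i) \<in> mspan T"
    by (rule ideal.I_r_closed[OF ideal_mspan]) simp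
  moreover have "mon a = mon t \<otimes> mon (\<lambda>i. a i - t i)" by (rule mon_le) (rule assms(2))
  ultimately show ?thesis by simp
qed

lemma mspan_subset_ideal: "ideal I R \<Longrightarrow> (\<And>t. t \<in> T \<Longrightarrow> mon t \<in> I) \<Longrightarrow> mspan T \<subseteq> I"
  unfolding mspan_def by (rule genideal_minimal) auto

lemma mspan_subset:
  assumes "\<And>s. s \<in> S \<Longrightarrow> \<exists>t\<in>T. \<forall>i\<in>V. t i \<le> s i"
  shows "mspan S \<subseteq> mspan T"
proof (rule mspan_subset_ideal[OF ideal_mspan])
  fix s assume "s \<in> S"
  then obtain t where "t \<in> T" "\<forall>i\<in>V. t i \<le> s i" using assms by blast
  then show "mon s \<in> mspan T" by (intro mon_in_mspan[of t]) auto
qed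

lemma mspan_mono: "S \<subseteq> T \<Longrightarrow> mspan S \<subseteq> mspan T"
  by (rule mspan_subset) auto

lemma mspan_subset_image:
  assumes "\<And>t i. t \<in> T \<Longrightarrow> i \<in> V \<Longrightarrow> f t i \<le> t i"
  shows "mspan T \<subseteq> mspan (f ` T)"
  by (rule mspan_subset) (use assms in blast)

lemma zero_in_mspan [simp]: "\<zero> \<in> mspan T"
  by (rule additive_subgroup.zero_closed[OF ideal.axioms(1)[OF ideal_mspan]])

lemma mspan_closed: "y \<in> mspan T \<Longrightarrow> y \<in> carrier R"
  by (rule ideal.Icarr[OF ideal_mspan])

lemma mspan_insertE:
  assumes "y \<in> mspan (insert a T)"
  obtains u r where "u \<in> mspan T" "r \<in> carrier R" "y = u \<oplus> mon a \<otimes> r"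
proof (rule Idl_insertE[of "mon ` T" "mon a" y])
  show "y \<in> Idl (insert (mon a) (mon ` T))" using assms by (simp add: mspan_def)
qed (use that in \<open>auto simp: mspan_def\<close>)

text \<open>The multipliers that \<open>b\<close> sends into \<open>I\<close> form an ideal, so
  checking the generators suffices.\<close>

lemma mult_mspan_in_ideal:
  assumes "ideal I R" "y \<in> mspan S" "b \<in> carrier R" "\<And>s. s \<in> S \<Longrightarrow> b \<otimes> mon s \<in> I"
  shows "b \<otimes> y \<in> I"
proof -
  have "mspan S \<subseteq> {k \<in> carrier R. b \<otimes> k \<in> I}"
    using assms(4) by (intro mspan_subset_ideal colon_ideal[OF assms(1,3)]) simp
  then show ?thesis using assms(2) by blast
qed

section \<open>Division by a variable and regularity of the variables\<close>

lemma x_mult_mon: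
  assumes "j \<in> V"
  shows "x j \<otimes> mon t = mon (t(j := Suc (t j)))"
proof -
  have "x j \<otimes> mon t = mon (single j 1) \<otimes> mon t" using mon_single[OF assms, of 1] assms by simp
  also have "\<dots> = mon (t(j := Suc (t j)))"
    unfolding mon_add[symmetric] by (rule mon_cong) simp
  finally show ?thesis .
qed

text \<open>A generator free of \<open>x j\<close> goes into the first summand, any other one is
  \<open>x j\<close> times a generator of the second kind. Truncated subtraction leaves the
  generators free of \<open>x j\<close> unchanged, so they also occur in the second generating
  set.\<close>

lemma mspan_decomp:
  assumes j: "j \<in> V" and "y \<in> mspan T"
  shows "\<exists>u\<in>mspan {t\<in>T. t j = 0}. \<exists>w\<in>mspan ((\<lambda>t. t(j := t j - 1)) ` T). y = u \<oplus> x j \<otimes> w"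
proof -
  let ?T0 = "{t\<in>T. t j = 0}" and ?T1 = "(\<lambda>t. t(j := t j - 1)) ` T"
  interpret T0: ideal "mspan ?T0" R by (rule ideal_mspan)
  interpret T1: ideal "mspan ?T1" R by (rule ideal_mspan)
  define K where "K = {u \<oplus> x j \<otimes> w | u w. u \<in> mspan ?T0 \<and> w \<in> mspan ?T1}"
  have K: "z \<in> K" if "z = u \<oplus> x j \<otimes> w" "u \<in> mspan ?T0" "w \<in> mspan ?T1" for z u w
    using that unfolding K_def by blast
  have "ideal K R"
  proof (rule ideal_of_closed)
    show "K \<subseteq> carrier R" using j T0.Icarr T1.Icarr by (auto simp: K_def)
    show "\<zero> \<in> K" using j by (intro K[of _ \<zero> \<zero>]) auto
    fix p assume "p \<in> K"
    then obtain u w where uw: "u \<in> mspan ?T0" "w \<in> mspan ?T1" "p = u \<oplus> x j \<otimes> w"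
      unfolding K_def by blast
    have c: "u \<in> carrier R" "w \<in> carrier R" "x j \<in> carrier R"
      using T0.Icarr[OF uw(1)] T1.Icarr[OF uw(2)] j by auto
    show "p \<oplus> q \<in> K" if q: "q \<in> K" for q
    proof -
      obtain u' w' where uw': "u' \<in> mspan ?T0" "w' \<in> mspan ?T1" "q = u' \<oplus> x j \<otimes> w'"
        using q unfolding K_def by blast
      have c': "u' \<in> carrier R" "w' \<in> carrier R"
        using T0.Icarr[OF uw'(1)] T1.Icarr[OF uw'(2)] by auto
      have "p \<oplus> q = (u \<oplus> u') \<oplus> x j \<otimes> (w \<oplus> w')"
        unfolding uw(3) uw'(3) using c c' by algebra
      then show ?thesis
        by (rule K) (rule T0.I_add_closed[OF uw(1) uw'(1)], rule T1.I_add_closed[OF uw(2) uw'(2)])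
    qed
    show "s \<otimes> p \<in> K" if s: "s \<in> carrier R" for s
    proof -
      have "s \<otimes> p = s \<otimes> u \<oplus> x j \<otimes> (s \<otimes> w)"
        unfolding uw(3) using c s by algebra
      then show ?thesis
        by (rule K) (rule T0.I_l_closed[OF uw(1) s], rule T1.I_l_closed[OF uw(2) s])
    qed
  qed
  moreover have "mon t \<in> K" if t: "t \<in> T" for t
  proof (cases "t j = 0")
    case True
    then have "mon t \<in> mspan ?T0" using t by (intro mon_in_mspan[of t]) auto
    then show ?thesis using j by (intro K[of _ "mon t" \<zero>]) auto
  next
    case False
    let ?t = "t(j := t j - 1)"
    have "mon t = mon (single j 1) \<otimes> mon ?t"
      using False by (subst mon_add[symmetric]) (auto intro!: mon_cong)
    then have "mon t = \<zero> \<oplus> x j \<otimes> mon ?t" using j by (simp add: mon_single)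
    moreover have "mon ?t \<in> mspan ?T1" using t by (intro mon_in_mspan[of ?t]) auto
    ultimately show ?thesis by (intro K[of _ \<zero> "mon ?t"]) auto
  qed
  ultimately have "mspan T \<subseteq> K" by (rule mspan_subset_ideal)
  then show ?thesis using assms(2) unfolding K_def by blast
qed

text \<open>With \<open>x j \<otimes> y = u \<oplus> x j \<otimes> w\<close> from
  \<open>mspan_decomp\<close>, the product \<open>x j \<otimes> (y \<ominus> w)\<close> is
  \<open>u\<close>, and cancelling \<open>x j\<close> shows that \<open>y\<close> and
  \<open>w\<close> agree modulo the generators free of \<open>x j\<close>. Regularity is a
  hypothesis here because the lemma is used inside the induction that establishes it.\<close>

lemma colon_x:
  assumes "j \<in> V" "y \<in> carrier R" "x j \<otimes> y \<in> mspan T"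
    and "regular_modulo R (mspan {t\<in>T. t j = 0}) (x j)"
  shows "y \<in> mspan ((\<lambda>t. t(j := t j - 1)) ` T)"
proof -
  let ?T0 = "{t\<in>T. t j = 0}" and ?T1 = "(\<lambda>t. t(j := t j - 1)) ` T"
  obtain u w where uw: "u \<in> mspan ?T0" "w \<in> mspan ?T1" "x j \<otimes> y = u \<oplus> x j \<otimes> w"
    using mspan_decomp[OF assms(1,3)] by blast
  have c: "u \<in> carrier R" "w \<in> carrier R" "x j \<in> carrier R"
    using mspan_closed[OF uw(1)] mspan_closed[OF uw(2)] assms(1) by auto
  have "x j \<otimes> (y \<ominus> w) = x j \<otimes> y \<ominus> x j \<otimes> w" using c assms(2) by algebra
  also have "\<dots> = u" unfolding uw(3) using c assms(2) by algebra
  finally have "x j \<otimes> (y \<ominus> w) \<in> mspan ?T0" using uw(1) by simp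
  then have "y \<ominus> w \<in> mspan ?T0"
    using regular_moduloD[OF assms(4), of "y \<ominus> w"] c assms(2) by simp
  moreover have "mspan T \<subseteq> mspan ?T1" by (rule mspan_subset_image) simp
  then have "mspan ?T0 \<subseteq> mspan ?T1" using mspan_mono[of ?T0 T] by auto
  ultimately have "(y \<ominus> w) \<oplus> w \<in> mspan ?T1"
    using ideal.I_add_closed[OF ideal_mspan _ uw(2)] by blast
  moreover have "(y \<ominus> w) \<oplus> w = y" using c assms(2) by algebra
  ultimately show ?thesis by simp
qed

text \<open>
  Induction on the total degree of the generators. If some generator is divisible by \<open>x j\<close> but different
  from it, then both \<open>I + (x j)\<close> and \<open>I : x j\<close> have generators of smaller total degree, and an
  element regular modulo both of them is regular modulo \<open>I\<close>. In the remaining case the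
  generators are some of the \<open>x j\<close>.
\<close>

lemma regular_modulo_mspan_finite:
  assumes "finite T" "i \<in> V" "\<And>t. t \<in> T \<Longrightarrow> t i = 0"
  shows "regular_modulo R (mspan T) (x i)"
  using assms
proof (induction "\<Sum>t\<in>T. sum t V" arbitrary: T i rule: less_induct)
  case less
  have xi: "x i \<in> carrier R" using less.prems by simp
  consider (unit) t where "t \<in> T" "sum t V = 0"
    | (linear) "\<And>t. t \<in> T \<Longrightarrow> sum t V = 1"
    | (nonlinear) t where "t \<in> T" "sum t V \<ge> 2"
  proof (cases "\<forall>t\<in>T. sum t V = 1")
    case True
    then show ?thesis using linear by blast
  next
    case False
    then obtain t where "t \<in> T" "sum t V \<noteq> 1" by blast
    then show ?thesis using unit[of t] nonlinear[of t] by linarith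
  qed
  then show ?case
  proof cases
    case unit
    \<comment> \<open>A generator of degree 0 is \<open>\<one>\<close>, and every element is regular
      modulo the whole ring.\<close>
    then have "\<one> \<in> mspan T"
      using mon_in_mspan[of t T t] mon_eq_one[of t] finite_V by simp
    then have "mspan T = carrier R" by (rule ideal.one_imp_carrier[OF ideal_mspan])
    then show ?thesis unfolding regular_modulo_def by simp
  next
    case linear
    define A where "A = {j \<in> V. \<exists>t\<in>T. t j = 1}"
    have mon_x: "mon t = x j" if t: "t \<in> T" "j \<in> V" "t j = 1" for t j
    proof -
      have "sum t V = t j + sum t (V - {j})" using t finite_V by (simp add: sum.remove)
      then have "sum t (V - {j}) = 0" using t linear by simp
      then have "mon t = mon (single j 1)" using t(3) finite_V by (intro mon_cong) auto
      then show ?thesis using t by (simp add: mon_single)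
    qed
    have "\<exists>j\<in>V. t j = 1" if "t \<in> T" for t
      using sum_eq_1_iff[OF finite_V, of t] linear[OF that] by auto
    then have "mon ` T = x ` A"
      using mon_x unfolding A_def by (force simp: image_iff)
    moreover have "regular_modulo R (Idl (x ` A)) (x i)"
      using less.prems(2,3) by (intro x_regular) (force simp: A_def)+
    ultimately show ?thesis by (simp add: mspan_def)
  next
    case nonlinear
    have "sum t V \<noteq> 0" using nonlinear(2) by simp
    then obtain j where j: "j \<in> V" "t j > 0" using finite_V by auto
    have ij: "i \<noteq> j" using j(2) less.prems(3)[OF nonlinear(1)] by auto
    define T0 where "T0 = {t\<in>T. t j = 0}"
    define T1 where "T1 = {t\<in>T. t j \<noteq> 0}"
    \<comment> \<open>For \<open>I = mspan T\<close>, the set \<open>T'\<close> generates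
      \<open>I + (x j)\<close>, since \<open>x j\<close> absorbs all of \<open>T1\<close>, and
      \<open>T''\<close> generates \<open>I : x j\<close>. The total degree drops for
      \<open>T'\<close> because \<open>T1\<close> contains \<open>t\<close> of degree at least 2 and
      is replaced by one generator of degree 1.\<close>
    define T' where "T' = insert (single j 1) T0"
    define T'' where "T'' = (\<lambda>t. t(j := t j - 1)) ` T"
    have "T0 \<union> T1 = T" unfolding T0_def T1_def by blast
    moreover have "T0 \<inter> T1 = {}" unfolding T0_def T1_def by blast
    moreover from calculation have "finite T0" "finite T1" using less.prems(1) by blast+
    ultimately have T: "T0 \<union> T1 = T" "T0 \<inter> T1 = {}" "finite T0" "finite T1" by blast+
    have sumT: "(\<Sum>t\<in>T. sum t V) = (\<Sum>t\<in>T0. sum t V) + (\<Sum>t\<in>T1. sum t V)"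
      using sum.union_disjoint[OF T(3,4,2)] unfolding T(1) .
    have tT1: "t \<in> T1" using nonlinear j unfolding T1_def by simp
    have "2 \<le> (\<Sum>t\<in>T1. sum t V)"
      using member_le_sum[OF tT1, of "\<lambda>t. sum t V"] T nonlinear by simp
    moreover have "single j 1 \<notin> T0" unfolding T0_def by simp
    moreover have "sum (single j 1) V = 1"
      using j finite_V by (simp add: sum.remove[of _ j])
    ultimately have lt': "(\<Sum>t\<in>T'. sum t V) < (\<Sum>t\<in>T. sum t V)"
      unfolding T'_def using T sumT by simp
    have lt0: "(\<Sum>t\<in>T0. sum t V) < (\<Sum>t\<in>T. sum t V)"
      using lt' T \<open>single j 1 \<notin> T0\<close> unfolding T'_def by simp
    \<comment> \<open>Only an inequality, since distinct generators may coincide after division by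
      \<open>x j\<close>.\<close>
    have "(\<Sum>t\<in>T''. sum t V) \<le> (\<Sum>t\<in>T. sum (t(j := t j - 1)) V)"
      using sum_image_le[OF less.prems(1), of "\<lambda>t. sum t V" "\<lambda>t. t(j := t j - 1)", OF zero_le]
      unfolding T''_def o_def .
    also have "\<dots> < (\<Sum>t\<in>T. sum t V)"
    proof (rule sum_strict_mono_ex1[OF less.prems(1)])
      show "\<forall>s\<in>T. sum (s(j := s j - 1)) V \<le> sum s V" by (auto intro!: sum_mono)
      show "\<exists>s\<in>T. sum (s(j := s j - 1)) V < sum s V"
        using nonlinear(1) j finite_V by (intro bexI[of _ t] sum_strict_mono_ex1) auto
    qed
    finally have lt'': "(\<Sum>t\<in>T''. sum t V) < (\<Sum>t\<in>T. sum t V)" .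
    have reg': "regular_modulo R (mspan T') (x i)"
      using less.prems T ij by (intro less.hyps[OF lt']) (auto simp: T'_def T0_def)
    have reg'': "regular_modulo R (mspan T'') (x i)"
      using less.prems ij by (intro less.hyps[OF lt'']) (auto simp: T''_def)
    \<comment> \<open>This is the hypothesis of \<open>colon_x\<close>, obtained from the induction
      hypothesis for the variable \<open>x j\<close> instead of \<open>x i\<close>.\<close>
    have reg0: "regular_modulo R (mspan T0) (x j)"
      using T j by (intro less.hyps[OF lt0]) (auto simp: T0_def)
    show ?thesis
      unfolding regular_modulo_def
    proof (intro ballI impI)
      fix y assume y: "y \<in> carrier R" "x i \<otimes> y \<in> mspan T"
      have "mspan T \<subseteq> mspan T'"
      proof (rule mspan_subset)
        fix s assume "s \<in> T"
        then show "\<exists>t\<in>T'. \<forall>i\<in>V. t i \<le> s i"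
          unfolding T'_def T0_def by (cases "s j = 0") auto
      qed
      then have "x i \<otimes> y \<in> mspan T'" using y(2) by blast
      then have "y \<in> mspan T'" by (rule regular_moduloD[OF reg' y(1)])
      \<comment> \<open>Modulo \<open>I + (x j)\<close> the factor \<open>x i\<close> cancels, so
        \<open>y = u \<oplus> x j \<otimes> r\<close> with \<open>u\<close> in \<open>I\<close>. It
        remains to cancel \<open>x i\<close> from \<open>x i \<otimes> r\<close> modulo
        \<open>I : x j\<close>.\<close>
      then obtain u r where ur: "u \<in> mspan T0" "r \<in> carrier R" "y = u \<oplus> mon (single j 1) \<otimes> r"
        unfolding T'_def by (rule mspan_insertE)
      have u: "u \<in> mspan T" using ur(1) mspan_mono[of T0 T] T by blast
      have c: "u \<in> carrier R" "x i \<in> carrier R" "x j \<in> carrier R"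
        using mspan_closed[OF ur(1)] xi j by auto
      have yeq: "y = u \<oplus> x j \<otimes> r" using ur(3) mon_single[OF j(1), of 1] c by simp
      have "x i \<otimes> u \<oplus> x j \<otimes> (x i \<otimes> r) = x i \<otimes> y" unfolding yeq using c ur(2) by algebra
      then have sum: "x i \<otimes> u \<oplus> x j \<otimes> (x i \<otimes> r) \<in> mspan T" using y(2) by simp
      have xu: "x i \<otimes> u \<in> mspan T" by (rule ideal.I_l_closed[OF ideal_mspan u c(2)])
      have xr: "x i \<otimes> r \<in> carrier R" "x j \<otimes> (x i \<otimes> r) \<in> carrier R" using c ur(2) by simp_all
      have "x j \<otimes> (x i \<otimes> r) \<in> mspan T"
        by (rule ideal.I_add_cancel_left[OF ideal_mspan xu xr(2) sum])
      then have "x i \<otimes> r \<in> mspan T''"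
        unfolding T''_def by (rule colon_x[OF j(1) xr(1) _ reg0[unfolded T0_def]])
      then have "r \<in> mspan T''" by (rule regular_moduloD[OF reg'' ur(2)])
      then have "x j \<otimes> r \<in> mspan T"
      proof (rule mult_mspan_in_ideal[OF ideal_mspan _ c(3)])
        fix s assume "s \<in> T''"
        then obtain t where t: "t \<in> T" "s = t(j := t j - 1)" unfolding T''_def by blast
        then show "x j \<otimes> mon s \<in> mspan T"
          unfolding x_mult_mon[OF j(1)] by (intro mon_in_mspan[of t]) auto
      qed
      then show "y \<in> mspan T"
        unfolding yeq by (rule ideal.I_add_closed[OF ideal_mspan u])
    qed
  qed
qed

section \<open>Arbitrary monomial ideals: colons, membership and intersections\<close>

lemma regular_modulo_mspan:
  assumes "i \<in> V" "\<And>t. t \<in> T \<Longrightarrow> t i = 0"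
  shows "regular_modulo R (mspan T) (x i)"
  unfolding regular_modulo_def
proof (intro ballI impI)
  fix y assume y: "y \<in> carrier R" "x i \<otimes> y \<in> mspan T"
  have "mon ` T \<subseteq> carrier R" by auto
  \<comment> \<open>The single element \<open>x i \<otimes> y\<close> involves only finitely many
    generators, so the finite case applies to those.\<close>
  then obtain F where F: "finite F" "F \<subseteq> mon ` T" "x i \<otimes> y \<in> Idl F"
    using y(2) unfolding mspan_def by (rule Idl_finite_support)
  then obtain S where S: "S \<subseteq> T" "finite S" "F = mon ` S"
    using finite_subset_image by meson
  have "regular_modulo R (mspan S) (x i)"
    using S assms by (intro regular_modulo_mspan_finite) auto
  then have "y \<in> mspan S" by (rule regular_moduloD[OF _ y(1)]) (use F S in \<open>simp add: mspan_def\<close>)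
  then show "y \<in> mspan T" using mspan_mono[OF S(1)] by blast
qed

text \<open>Induction on the degree of \<open>a\<close>, dividing by one variable at a time with
  \<open>colon_x\<close>. The truncated difference \<open>t i - a i\<close> is the exponent of the
  monomial of \<open>t\<close> divided by its greatest common divisor with that of
  \<open>a\<close>.\<close>

lemma colon_mon:
  assumes "y \<in> carrier R" "mon a \<otimes> y \<in> mspan T"
  shows "y \<in> mspan ((\<lambda>t i. t i - a i) ` T)"
  using assms
proof (induction "sum a V" arbitrary: a T)
  case 0
  then have a: "a i = 0" if "i \<in> V" for i using finite_V that by simp
  then have "y \<in> mspan T" using 0 mon_eq_one[of a] by simp
  moreover have "mspan T \<subseteq> mspan ((\<lambda>t i. t i - a i) ` T)" by (rule mspan_subset_image) simp
  ultimately show ?case by blast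
next
  case (Suc n)
  then obtain j where j: "j \<in> V" "a j > 0"
    by (metis gr0I nat.distinct(1) sum.neutral)
  let ?a = "a(j := a j - 1)"
  have sum: "n = sum ?a V"
    using Suc.hyps(2) j finite_V by (simp add: sum.remove[of _ j])
  have "mon a = x j \<otimes> mon ?a" using j by (simp add: x_mult_mon)
  then have "x j \<otimes> (mon ?a \<otimes> y) \<in> mspan T" using Suc.prems j by (simp add: m_assoc)
  then have "mon ?a \<otimes> y \<in> mspan ((\<lambda>t. t(j := t j - 1)) ` T)"
    using j Suc.prems by (intro colon_x regular_modulo_mspan) auto
  from Suc.hyps(1)[OF sum Suc.prems(1) this]
  have "y \<in> mspan ((\<lambda>t i. t i - ?a i) ` (\<lambda>t. t(j := t j - 1)) ` T)" .
  also have "(\<lambda>t i. t i - ?a i) ` (\<lambda>t. t(j := t j - 1)) ` T = (\<lambda>t i. t i - a i) ` T"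
    unfolding image_image using j by (intro image_cong) auto
  finally show ?case .
qed

text \<open>The colon ideal by \<open>mon a\<close> contains \<open>\<one>\<close>. If no
  \<open>t\<close> divided \<open>a\<close>, every truncated difference would have a positive
  exponent, and by \<open>colon_mon\<close> the ideal of all variables would contain
  \<open>\<one>\<close>, although it is proper.\<close>

lemma mon_in_mspanD:
  assumes "mon a \<in> mspan T"
  shows "\<exists>t\<in>T. \<forall>i\<in>V. t i \<le> a i"
proof (rule ccontr)
  assume neg: "\<not> (\<exists>t\<in>T. \<forall>i\<in>V. t i \<le> a i)"
  let ?T = "(\<lambda>t i. t i - a i) ` T"
  have idl: "ideal (Idl (x ` V)) R" using x_closed by (rule genideal_ideal)
  have "\<one> \<in> mspan ?T" using assms by (intro colon_mon) auto
  moreover have "mspan ?T \<subseteq> Idl (x ` V)"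
  proof (rule mspan_subset_ideal[OF idl])
    fix s assume "s \<in> ?T"
    then obtain j where j: "j \<in> V" "s j > 0" using neg by fastforce
    then have "mon s = x j \<otimes> mon (s(j := s j - 1))" by (simp add: x_mult_mon)
    moreover have "x j \<in> Idl (x ` V)" using genideal_self[OF x_closed] j by blast
    ultimately show "mon s \<in> Idl (x ` V)" using ideal.I_r_closed[OF idl] by simp
  qed
  ultimately have "Idl (x ` V) = carrier R" using ideal.one_imp_carrier[OF idl] by blast
  then show False using x_proper by blast
qed

text \<open>For \<open>z = u \<oplus> mon a \<otimes> r\<close> in the intersection,
  \<open>r\<close> lies in the colon of \<open>mspan (insert b T)\<close> by \<open>mon a\<close>.
  Multiplying a generator of that colon by \<open>mon a\<close> gives the least common multiple of
  \<open>mon a\<close> and \<open>mon t\<close>. It lies in \<open>mspan T\<close> as a multiple of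
  \<open>mon t\<close> if \<open>t\<close> is in \<open>T\<close>, and by assumption if
  \<open>t = b\<close>.\<close>

lemma mspan_insert_Int_subset:
  assumes "mon (\<lambda>i. max (a i) (b i)) \<in> mspan T"
  shows "mspan (insert a T) \<inter> mspan (insert b T) \<subseteq> mspan T"
proof
  fix z assume z: "z \<in> mspan (insert a T) \<inter> mspan (insert b T)"
  then have "z \<in> mspan (insert a T)" by blast
  then obtain u r where ur: "u \<in> mspan T" "r \<in> carrier R" "z = u \<oplus> mon a \<otimes> r"
    by (rule mspan_insertE)
  have "u \<in> mspan (insert b T)" using ur(1) mspan_mono[of T "insert b T"] by blast
  then have "mon a \<otimes> r \<in> mspan (insert b T)"
    using ideal.I_add_cancel_left[OF ideal_mspan, of u _ "mon a \<otimes> r"] z ur by auto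
  then have "r \<in> mspan ((\<lambda>t i. t i - a i) ` insert b T)" by (rule colon_mon[OF ur(2)])
  then have "mon a \<otimes> r \<in> mspan T"
  proof (rule mult_mspan_in_ideal[OF ideal_mspan])
    fix s assume "s \<in> (\<lambda>t i. t i - a i) ` insert b T"
    then obtain t where t: "t \<in> insert b T" "s = (\<lambda>i. t i - a i)" by blast
    have "mon a \<otimes> mon s = mon (\<lambda>i. max (a i) (t i))"
      unfolding mon_add[symmetric] t(2) by (rule mon_cong) auto
    moreover have "mon (\<lambda>i. max (a i) (t i)) \<in> mspan T"
    proof (cases "t = b")
      case False
      then show ?thesis using t(1) by (intro mon_in_mspan[of t]) auto
    qed (use assms in simp)
    ultimately show "mon a \<otimes> mon s \<in> mspan T" by simp
  qed simp
  then show "z \<in> mspan T" unfolding ur(3) by (rule ideal.I_add_closed[OF ideal_mspan ur(1)])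
qed

section \<open>Ideals generated by powers of variables\<close>

lemma mspan_singles:
  assumes "A \<subseteq> V"
  shows "mspan ((\<lambda>i. single i (e i)) ` A) = Idl ((\<lambda>i. x i [^] e i) ` A)"
proof -
  have "(\<lambda>i. mon (single i (e i))) ` A = (\<lambda>i. x i [^] e i) ` A"
    using assms by (intro image_cong mon_single) auto
  then show ?thesis by (simp add: mspan_def image_image)
qed

lemma mon_in_singles_iff:
  assumes "A \<subseteq> V"
  shows "mon a \<in> mspan ((\<lambda>i. single i (e i)) ` A) \<longleftrightarrow> (\<exists>i\<in>A. e i \<le> a i)"
proof
  assume "mon a \<in> mspan ((\<lambda>i. single i (e i)) ` A)"
  then obtain i where "i \<in> A" "\<forall>k\<in>V. single i (e i) k \<le> a k" using mon_in_mspanD by blast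
  then have "i \<in> A" "e i \<le> a i" using assms by force+
  then show "\<exists>i\<in>A. e i \<le> a i" by blast
next
  assume "\<exists>i\<in>A. e i \<le> a i"
  then obtain i where "i \<in> A" "e i \<le> a i" by blast
  then show "mon a \<in> mspan ((\<lambda>i. single i (e i)) ` A)"
    by (intro mon_in_mspan[of "single i (e i)"]) auto
qed

text \<open>If both ideals were larger than \<open>I\<close>, each would have a generator outside
  \<open>I\<close>. Their least common multiple lies in both ideals, hence in \<open>I\<close>, but
  the exponents outside \<open>I\<close> form a box, which is closed under maxima.\<close>

lemma singles_irreducible:
  assumes "A \<subseteq> V" and I: "I = mspan ((\<lambda>i. single i (e i)) ` A)"
    and "I = mspan S \<inter> mspan T"
  shows "I = mspan S \<or> I = mspan T"
proof (rule ccontr)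
  assume neg: "\<not> (I = mspan S \<or> I = mspan T)"
  have id: "ideal I R" unfolding I by (rule ideal_mspan)
  have "\<not> mspan S \<subseteq> I" "\<not> mspan T \<subseteq> I" using neg assms(3) by auto
  then obtain s t where st: "s \<in> S" "mon s \<notin> I" "t \<in> T" "mon t \<notin> I"
    using mspan_subset_ideal[OF id] by metis
  have "mon (\<lambda>i. max (s i) (t i)) \<in> mspan S" using st by (intro mon_in_mspan[of s]) auto
  moreover have "mon (\<lambda>i. max (s i) (t i)) \<in> mspan T" using st by (intro mon_in_mspan[of t]) auto
  ultimately have "mon (\<lambda>i. max (s i) (t i)) \<in> I" using assms(3) by blast
  then show False
    using st(2,4) unfolding I mon_in_singles_iff[OF assms(1)] by (auto simp: le_max_iff_disj)
qed

lemma singles_nontrivial: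
  assumes "A \<subseteq> V" "A \<noteq> {}" "\<And>i. i \<in> A \<Longrightarrow> 0 < e i" and I: "I = mspan ((\<lambda>i. single i (e i)) ` A)"
  shows "I \<noteq> {\<zero>}" "I \<noteq> carrier R"
proof -
  \<comment> \<open>A monomial equal to \<open>\<zero>\<close> would lie in \<open>mspan {}\<close>
    and so would need a divisor in the empty set.\<close>
  have nz: "mon a \<noteq> \<zero>" for a
    using mon_in_mspanD[of a "{}"] zero_in_mspan[of "{}"] by auto
  obtain i where "i \<in> A" using assms(2) by blast
  then have "mon e \<in> I" unfolding I mon_in_singles_iff[OF assms(1)] by blast
  then show "I \<noteq> {\<zero>}" using nz[of e] by blast
  have "mon (\<lambda>_. 0) \<notin> I"
    unfolding I mon_in_singles_iff[OF assms(1)] using assms(3) by auto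
  then show "I \<noteq> carrier R" using mon_closed by blast
qed

text \<open>Every monomial is the least common multiple of the powers of single variables dividing
  it. Applying \<open>directed\<close> repeatedly shows that a monomial of \<open>I\<close> has one
  of these powers in \<open>I\<close>, so pure powers generate \<open>I\<close>.\<close>

lemma singles_of_directed:
  assumes I: "I = mspan T" and "I \<noteq> {\<zero>}" "I \<noteq> carrier R"
    and directed: "\<And>a b. mon (\<lambda>i. max (a i) (b i)) \<in> I \<Longrightarrow> mon a \<in> I \<or> mon b \<in> I"
  shows "\<exists>A e. A \<subseteq> V \<and> A \<noteq> {} \<and> (\<forall>i\<in>A. 0 < e i) \<and> I = mspan ((\<lambda>i. single i (e i)) ` A)"
proof -
  have one: "mon (\<lambda>_. 0) \<notin> I"
  proof
    assume "mon (\<lambda>_. 0) \<in> I"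
    then have "\<one> \<in> mspan T" using mon_eq_one[of "\<lambda>_. 0"] I by simp
    then show False using ideal.one_imp_carrier[OF ideal_mspan] I assms(3) by blast
  qed
  have power: "\<exists>i\<in>V. mon (single i (a i)) \<in> I" if a: "mon a \<in> I" for a
  proof (rule ccontr)
    assume neg: "\<not> (\<exists>i\<in>V. mon (single i (a i)) \<in> I)"
    \<comment> \<open>The monomial is rebuilt one variable at a time: the empty restriction gives
      \<open>\<one>\<close>, which is outside \<open>I\<close>, and adding a variable takes a
      maximum of two exponents outside \<open>I\<close>.\<close>
    have "mon (\<lambda>i. if i \<in> B then a i else 0) \<notin> I" if "finite B" "B \<subseteq> V" for B
      using that
    proof (induction B rule: finite_induct)
      case empty
      then show ?case using one by simp
    next
      case (insert b B)
      have eq: "(\<lambda>i. if i \<in> insert b B then a i else 0)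
          = (\<lambda>i. max (single b (a b) i) (if i \<in> B then a i else 0))"
        using insert.hyps by auto
      have "mon (single b (a b)) \<notin> I" "mon (\<lambda>i. if i \<in> B then a i else 0) \<notin> I"
        using insert neg by blast+
      then show ?case
        unfolding eq using directed[of "single b (a b)" "\<lambda>i. if i \<in> B then a i else 0"] by auto
    qed
    from this[OF finite_V order_refl] have "mon (\<lambda>i. if i \<in> V then a i else 0) \<notin> I" .
    moreover have "mon (\<lambda>i. if i \<in> V then a i else 0) = mon a" by (rule mon_cong) simp
    ultimately show False using a by simp
  qed
  \<comment> \<open>The sides of the box: \<open>A\<close> collects the variables having some power
    in \<open>I\<close>, and \<open>e i\<close> is the least such exponent.\<close>
  define A where "A = {i\<in>V. \<exists>n. mon (single i n) \<in> I}"
  define e where "e i = (LEAST n. mon (single i n) \<in> I)" for i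
  have e: "mon (single i (e i)) \<in> I" if "i \<in> A" for i
    using that unfolding A_def e_def by (auto intro: LeastI)
  have e_le: "e i \<le> n" if "mon (single i n) \<in> I" for i n
    using that unfolding e_def by (rule Least_le)
  have pos: "0 < e i" if "i \<in> A" for i
  proof (rule ccontr)
    assume "\<not> 0 < e i"
    then have "single i (e i) = (\<lambda>_. 0)" by auto
    then show False using e[OF that] one by simp
  qed
  have "mspan ((\<lambda>i. single i (e i)) ` A) = I"
  proof
    show "mspan ((\<lambda>i. single i (e i)) ` A) \<subseteq> I"
      using e ideal_mspan[of T] I by (intro mspan_subset_ideal) auto
    show "I \<subseteq> mspan ((\<lambda>i. single i (e i)) ` A)"
      unfolding I
    proof (rule mspan_subset)
      fix t assume "t \<in> T"
      then have "mon t \<in> I" unfolding I by (intro mon_in_mspan[of t]) auto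
      then obtain i where i: "i \<in> V" "mon (single i (t i)) \<in> I" using power by blast
      then have "i \<in> A" "e i \<le> t i" using e_le unfolding A_def by blast+
      then show "\<exists>s\<in>(\<lambda>i. single i (e i)) ` A. \<forall>k\<in>V. s k \<le> t k"
        by (intro bexI[of _ "single i (e i)"]) auto
    qed
  qed
  moreover have "A \<noteq> {}"
  proof
    assume "A = {}"
    then have "I \<subseteq> {\<zero>}"
      using calculation mspan_subset_ideal[OF zeroideal, of "{}"] by auto
    moreover have "\<zero> \<in> I" using I by simp
    ultimately show False using assms(2) by blast
  qed
  moreover have "A \<subseteq> V" unfolding A_def by blast
  ultimately show ?thesis using pos by blast
qed

end

section \<open>Generalized-parameter ideals\<close>

text \<open>A bijection from the first \<open>card A\<close> indices onto \<open>A\<close> is glued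
  with one between the complements and extended by the identity.\<close>

lemma ex_permutation_image:
  assumes "A \<subseteq> {1..d::nat}"
  shows "\<exists>\<tau>. \<tau> permutes {1..d} \<and> \<tau> ` {1..card A} = A"
proof -
  let ?s = "card A"
  have fin: "finite A" using assms by (rule finite_subset) simp
  have sd: "?s \<le> d" using card_mono[OF _ assms] by simp
  obtain f where f: "bij_betw f {1..?s} A"
    using fin finite_same_card_bij[of "{1..?s}" A] by auto
  have "card {?s + 1..d} = card ({1..d} - A)" using assms fin by (simp add: card_Diff_subset)
  then obtain g where g: "bij_betw g {?s + 1..d} ({1..d} - A)"
    using finite_same_card_bij[of "{?s + 1..d}" "{1..d} - A"] by auto
  define \<tau> where "\<tau> i = (if i \<in> {1..?s} then f i else if i \<in> {?s + 1..d} then g i else i)" for i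
  have \<tau>A: "bij_betw \<tau> {1..?s} A"
    using f by (rule bij_betw_cong[THEN iffD1, rotated]) (simp add: \<tau>_def)
  moreover have "bij_betw \<tau> {?s + 1..d} ({1..d} - A)"
    using g by (rule bij_betw_cong[THEN iffD1, rotated]) (simp add: \<tau>_def)
  ultimately have "bij_betw \<tau> ({1..?s} \<union> {?s + 1..d}) (A \<union> ({1..d} - A))"
    by (rule bij_betw_combine) auto
  moreover have "{1..?s} \<union> {?s + 1..d} = {1..d}" "A \<union> ({1..d} - A) = {1..d}" using sd assms by auto
  ultimately have "bij_betw \<tau> {1..d} {1..d}" by simp
  then have "\<tau> permutes {1..d}"
  proof (rule bij_imp_permutes)
    fix i assume "i \<notin> {1..d}"
    then have "i \<notin> {1..?s}" "i \<notin> {?s + 1..d}" using sd by auto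
    then show "\<tau> i = i" by (simp only: \<tau>_def if_False)
  qed
  moreover have "\<tau> ` {1..?s} = A" by (rule bij_betw_imp_surj_on[OF \<tau>A])
  ultimately show ?thesis by blast
qed

text \<open>Trades the permutation for the set \<open>A\<close> of variables that occur, with
  exponents indexed by the variable instead of its position. Injectivity of \<open>\<tau>\<close>
  makes this reindexing well defined, and \<open>ex_permutation_image\<close> recovers a permutation
  from \<open>A\<close>.\<close>

lemma generalized_parameter_ideal_iff:
  assumes "monomial_ideal R d x I"
  shows "generalized_parameter_ideal R d x I \<longleftrightarrow>
    (\<exists>A e. A \<subseteq> {1..d} \<and> A \<noteq> {} \<and> (\<forall>i\<in>A. 0 < e i) \<and> I = Idl\<^bsub>R\<^esub> ((\<lambda>i. x i [^]\<^bsub>R\<^esub> (e i :: nat)) ` A))"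
    (is "?L \<longleftrightarrow> ?R")
proof
  assume ?L
  then obtain s \<tau> and e :: "nat \<Rightarrow> nat"
    where s: "1 \<le> s" "s \<le> d" and \<tau>: "\<tau> permutes {1..d}" and e: "\<forall>i\<in>{1..s}. 0 < e i"
      and I: "I = Idl\<^bsub>R\<^esub> ((\<lambda>i. x (\<tau> i) [^]\<^bsub>R\<^esub> e i) ` {1..s})"
    unfolding generalized_parameter_ideal_def by blast
  have inv: "inv_into UNIV \<tau> (\<tau> i) = i" for i using permutes_inverses[OF \<tau>] by simp
  have "\<tau> ` {1..s} \<subseteq> \<tau> ` {1..d}" using s by (intro image_mono) auto
  then have "\<tau> ` {1..s} \<subseteq> {1..d}" using permutes_image[OF \<tau>] by simp
  moreover have "\<tau> ` {1..s} \<noteq> {}" using s by simp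
  moreover have "\<forall>i\<in>\<tau> ` {1..s}. 0 < (e \<circ> inv_into UNIV \<tau>) i" using e by (simp add: inv)
  moreover have "I = Idl\<^bsub>R\<^esub> ((\<lambda>i. x i [^]\<^bsub>R\<^esub> (e \<circ> inv_into UNIV \<tau>) i) ` \<tau> ` {1..s})"
    unfolding I by (simp add: image_image inv)
  ultimately show ?R by blast
next
  assume ?R
  then obtain A and e :: "nat \<Rightarrow> nat" where A: "A \<subseteq> {1..d}" "A \<noteq> {}" "\<forall>i\<in>A. 0 < e i"
    and I: "I = Idl\<^bsub>R\<^esub> ((\<lambda>i. x i [^]\<^bsub>R\<^esub> e i) ` A)" by blast
  obtain \<tau> where \<tau>: "\<tau> permutes {1..d}" "\<tau> ` {1..card A} = A"
    using ex_permutation_image[OF A(1)] by blast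
  have fin: "finite A" using A(1) by (rule finite_subset) simp
  have "1 \<le> card A" using A(2) fin by (simp add: Suc_le_eq card_gt_0_iff)
  moreover have "card A \<le> d" using card_mono[OF _ A(1)] by simp
  moreover have "\<forall>i\<in>{1..card A}. 0 < (e \<circ> \<tau>) i" using A(3) \<tau>(2) by auto
  moreover have "I = Idl\<^bsub>R\<^esub> ((\<lambda>i. x (\<tau> i) [^]\<^bsub>R\<^esub> (e \<circ> \<tau>) i) ` {1..card A})"
  proof -
    have "(\<lambda>i. x i [^]\<^bsub>R\<^esub> e i) ` \<tau> ` {1..card A} = (\<lambda>i. x (\<tau> i) [^]\<^bsub>R\<^esub> (e \<circ> \<tau>) i) ` {1..card A}"
      by (simp add: image_image)
    then show ?thesis unfolding I \<tau>(2) by simp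
  qed
  ultimately show ?L
    unfolding generalized_parameter_ideal_def using assms \<tau>(1) by blast
qed

text \<open>The zero ideal and the ring itself count as monomial ideals and are irreducible, but
  neither is a generalized-parameter ideal, because at least one power occurs and all exponents are
  positive. Hence the two exclusions on the left-hand side.\<close>

theorem corollary2p5:
  fixes R :: "('a, 'b) ring_scheme" and d :: nat and x :: "nat \<Rightarrow> 'a" and I :: "'a set"
  assumes "cring R" and "noetherian_ring R"
    and "regular_sequence R d x"
    and "x ` {1..d} \<subseteq> jacobson_radical R"
    and "monomial_ideal R d x I"
  shows "(irreducible_monomial_ideal R d x I \<and> I \<noteq> {\<zero>\<^bsub>R\<^esub>} \<and> I \<noteq> carrier R)
           \<longleftrightarrow> generalized_parameter_ideal R d x I"
proof -
  interpret noetherian_cring R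
    using assms(1,2) by (rule noetherian_cring.intro)
  interpret permutable_regular_sequence R "{1..d}" x
  proof
    show "regular_modulo R (Idl\<^bsub>R\<^esub> (x ` A)) (x i)" if "A \<subseteq> {1..d}" "i \<in> {1..d} - A" for A i
      using regular_modulo_subset_of_regular_sequence[OF assms(3,4) order_refl that] .
  qed (use regular_sequence_closed[OF assms(3)] regular_sequence_proper[OF assms(3)] in simp_all)
  have monomials: "monomials R d x = range mon"
    unfolding monomials_def mon_def by blast
  have monomial_ideal: "monomial_ideal R d x J \<longleftrightarrow> (\<exists>T. J = mspan T)" for J
  proof
    assume "monomial_ideal R d x J"
    then obtain S where S: "S \<subseteq> range mon" "J = Idl\<^bsub>R\<^esub> S"
      unfolding monomial_ideal_def monomials by blast
    then obtain T where "S = mon ` T" by (auto simp: subset_image_iff)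
    then show "\<exists>T. J = mspan T" using S(2) unfolding mspan_def by blast
  next
    assume "\<exists>T. J = mspan T"
    then obtain T where "J = Idl\<^bsub>R\<^esub> (mon ` T)" unfolding mspan_def ..
    moreover have "mon ` T \<subseteq> range mon" by (rule image_mono) simp
    ultimately show "monomial_ideal R d x J"
      unfolding monomial_ideal_def monomials by (intro exI[of _ "mon ` T"] conjI)
  qed
  have singles: "generalized_parameter_ideal R d x I \<longleftrightarrow>
      (\<exists>A e. A \<subseteq> {1..d} \<and> A \<noteq> {} \<and> (\<forall>i\<in>A. 0 < e i) \<and> I = mspan ((\<lambda>i. single i (e i)) ` A))"
    unfolding generalized_parameter_ideal_iff[OF assms(5)]
    by (intro iff_exI conj_cong refl) (simp only: mspan_singles)
  obtain T where T: "I = mspan T" using assms(5) monomial_ideal by blast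
  show ?thesis
  proof
    assume L: "irreducible_monomial_ideal R d x I \<and> I \<noteq> {\<zero>\<^bsub>R\<^esub>} \<and> I \<noteq> carrier R"
    have directed: "mon a \<in> I \<or> mon b \<in> I" if ab: "mon (\<lambda>i. max (a i) (b i)) \<in> I" for a b
    proof -
      \<comment> \<open>Irreducibility is applied to this intersection: \<open>I\<close> must equal
        one of the two ideals and so contains the monomial adjoined there.\<close>
      have "I = mspan (insert a T) \<inter> mspan (insert b T)"
        using mspan_insert_Int_subset[of a b T] ab mspan_mono[of T "insert a T"]
          mspan_mono[of T "insert b T"] unfolding T by blast
      moreover have "monomial_ideal R d x (mspan (insert a T))"
          "monomial_ideal R d x (mspan (insert b T))" using monomial_ideal by blast+
      ultimately have "I = mspan (insert a T) \<or> I = mspan (insert b T)"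
        using L unfolding irreducible_monomial_ideal_def reducible_monomial_ideal_def by blast
      moreover have "mon a \<in> mspan (insert a T)" "mon b \<in> mspan (insert b T)"
        by (rule mon_in_mspan[OF insertI1 order_refl])+
      ultimately show ?thesis by blast
    qed
    show "generalized_parameter_ideal R d x I"
      unfolding singles by (rule singles_of_directed[OF T]) (use L directed in blast)+
  next
    assume "generalized_parameter_ideal R d x I"
    then obtain A e where A: "A \<subseteq> {1..d}" "A \<noteq> {}" "\<forall>i\<in>A. 0 < e i"
      and I: "I = mspan ((\<lambda>i. single i (e i)) ` A)" unfolding singles by blast
    have "\<not> reducible_monomial_ideal R d x I"
      unfolding reducible_monomial_ideal_def monomial_ideal
      using singles_irreducible[OF A(1) I] by blast
    moreover have "I \<noteq> {\<zero>\<^bsub>R\<^esub>}" "I \<noteq> carrier R"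
      using singles_nontrivial[OF A(1,2) _ I] A(3) by blast+
    ultimately show "irreducible_monomial_ideal R d x I \<and> I \<noteq> {\<zero>\<^bsub>R\<^esub>} \<and> I \<noteq> carrier R"
      unfolding irreducible_monomial_ideal_def using assms(5) by blast
  qed
qed

end
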